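(* Let $X$ be a locally convex space, let $\mathcal{I}$ be an ideal on $\omega$, and let $\bm{x}=(x_n)_{n\in\omega}$ be a sequence taking values in $X$ such that $\{n\in\omega: x_n\notin K\}\in\mathcal{I}$ for some compact $K\subseteq X$. Let $\mathscr{F}=\{F_\eta:\eta\in X\}$ be a rough family such that every $F_\eta$ is closed and convex. Then $$\mathsf{L}_{\bm{x}}(\mathcal{I},\mathscr{F})=\left\{\eta\in X:\mathrm{core}_{\bm{x}}(\mathcal{I})\subseteq F_\eta\right\}.$$
   Context: $\omega$ denotes the set of nonnegative integers. An ideal on $\omega$ is a family $\mathcal{I}\subseteq\mathcal{P}(\omega)$ closed under subsets and finite unions, containing all finite subsets of $\omega$, and with $\omega\notin\mathcal{I}$. Its dual filter is $\mathcal{I}^\star:=\{S\subseteq\omega:\omega\setminus S\in\mathcal{I}\}$. A locally convex space is a locally convex topological vector space. A rough family on a topological space $X$ is a collection $\mathscr{F}=\{F_\eta:\eta\in X\}$ of subsets of $X$ such that $\eta\in F_\eta$ for all $\eta\in X$. A sequence $(x_n)_{n\in\omega}$ in $X$ is $\mathcal{I}$-convergent to $\eta\in X$ with roughness $\mathscr{F}$, written $(\mathcal{I},\mathscr{F})\text{-}\lim_n x_n=\eta$, if $\{n\in\omega: x_n\notin U\}\in\mathcal{I}$ for all open sets $U\subseteq X$ with $F_\eta\subseteq U$. The set of all such limits is $\mathsf{L}_{\bm{x}}(\mathcal{I},\mathscr{F}):=\{\eta\in X:(\mathcal{I},\mathscr{F})\text{-}\lim_n x_n=\eta\}$. For a sequence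 $\bm{x}=(x_n)$ in a topological vector space, the $\mathcal{I}$-core is $$\mathrm{core}_{\bm{x}}(\mathcal{I}):=\bigcap_{E\in\mathcal{I}^\star}\overline{\mathrm{co}}(\{x_n:n\in E\}),$$ where $\overline{\mathrm{co}}$ is the closed convex hull operator. *)

theory Defs
  imports "HOL-Analysis.Analysis"
begin

text \<open>
  Real locally convex topological vector spaces: addition and scalar multiplication are jointly
  continuous and the origin has a base of convex neighbourhoods. The Hausdorff property is not
  required.
\<close>

class locally_convex_space = real_vector + topological_ab_group_add +
  assumes tendsto_scaleR_Pair:
      "LIM p (nhds c \<times>\<^sub>F nhds a). fst p *\<^sub>R snd p :> nhds (c *\<^sub>R a)"
    and locally_convex_zero:
      "open U \<Longrightarrow> 0 \<in> U \<Longrightarrow>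
         \<exists>V. open V \<and>
           (\<forall>x\<in>V. \<forall>y\<in>V. \<forall>u\<ge>0. \<forall>v\<ge>0. u + v = 1 \<longrightarrow> u *\<^sub>R x + v *\<^sub>R y \<in> V) \<and>
           0 \<in> V \<and> V \<subseteq> U"

text \<open>
  The constant \<^const>\<open>convex\<close> cannot be used in a class specification, so its definition is
  unfolded there.
\<close>

lemma locally_convex_zero_convex:
  fixes U :: "'a::locally_convex_space set"
  assumes "open U" "0 \<in> U"
  shows "\<exists>V. open V \<and> convex V \<and> 0 \<in> V \<and> V \<subseteq> U"
  using locally_convex_zero[OF assms] unfolding convex_def .

instance real_normed_vector \<subseteq> locally_convex_space
proof
  fix c :: real and a :: 'a
  show "LIM p (nhds c \<times>\<^sub>F nhds a). fst p *\<^sub>R snd p :> nhds (c *\<^sub>R a)"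
    unfolding nhds_prod[symmetric]
    by (intro tendsto_intros) (simp_all add: filterlim_fst filterlim_snd nhds_prod)
next
  fix U :: "'a set"
  assume "open U" "0 \<in> U"
  then obtain e where "0 < e" "ball 0 e \<subseteq> U"
    using openE by blast
  then have "\<exists>V. open V \<and> convex V \<and> 0 \<in> V \<and> V \<subseteq> U"
    by (intro exI[of _ "ball 0 e"]) auto
  then show "\<exists>V. open V \<and>
      (\<forall>x\<in>V. \<forall>y\<in>V. \<forall>u\<ge>0. \<forall>v\<ge>0. u + v = 1 \<longrightarrow> u *\<^sub>R x + v *\<^sub>R y \<in> V) \<and>
      0 \<in> V \<and> V \<subseteq> U"
    unfolding convex_def .
qed

definition ideal_on_omega :: "nat set set \<Rightarrow> bool" where
  "ideal_on_omega I \<longleftrightarrow>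
     (\<forall>A B. A \<in> I \<longrightarrow> B \<subseteq> A \<longrightarrow> B \<in> I) \<and>
     (\<forall>A B. A \<in> I \<longrightarrow> B \<in> I \<longrightarrow> A \<union> B \<in> I) \<and>
     (\<forall>A. finite A \<longrightarrow> A \<in> I) \<and>
     UNIV \<notin> I"

definition dual_filter :: "nat set set \<Rightarrow> nat set set" where
  "dual_filter I = {S. - S \<in> I}"

definition rough_family :: "('a::topological_space \<Rightarrow> 'a set) \<Rightarrow> bool" where
  "rough_family F \<longleftrightarrow> (\<forall>\<eta>. \<eta> \<in> F \<eta>)"

definition rough_lim ::
  "nat set set \<Rightarrow> ('a::topological_space \<Rightarrow> 'a set) \<Rightarrow> (nat \<Rightarrow> 'a) \<Rightarrow> 'a \<Rightarrow> bool" where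
  "rough_lim I F x \<eta> \<longleftrightarrow> (\<forall>U. open U \<longrightarrow> F \<eta> \<subseteq> U \<longrightarrow> {n. x n \<notin> U} \<in> I)"

definition rough_limits ::
  "(nat \<Rightarrow> 'a::topological_space) \<Rightarrow> nat set set \<Rightarrow> ('a \<Rightarrow> 'a set) \<Rightarrow> 'a set" where
  "rough_limits x I F = {\<eta>. rough_lim I F x \<eta>}"

definition closed_convex_hull :: "'a::{real_vector, topological_space} set \<Rightarrow> 'a set" where
  "closed_convex_hull S = (\<lambda>C. closed C \<and> convex C) hull S"

text \<open>In a topological vector space this is the closure of the convex hull.\<close>

lemma convex_closure_lcs:
  fixes S :: "'a::locally_convex_space set"
  assumes "convex S"
  shows "convex (closure S)"
proof (rule convexI)
  fix x y :: 'a and u v :: real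
  assume x: "x \<in> closure S" and y: "y \<in> closure S" and uv: "0 \<le> u" "0 \<le> v" "u + v = 1"
  let ?f = "\<lambda>p::'a \<times> 'a. u *\<^sub>R fst p + v *\<^sub>R snd p"
  have scale: "continuous_on UNIV (\<lambda>z::'a. c *\<^sub>R z)" for c :: real
    unfolding continuous_on_def
  proof
    fix a :: 'a
    have "((\<lambda>z::'a. (c, z)) \<longlongrightarrow> (c, a)) (nhds a)"
      by (intro tendsto_Pair tendsto_const) (simp add: filterlim_ident)
    then have "filterlim (\<lambda>z::'a. (c, z)) (nhds c \<times>\<^sub>F nhds a) (nhds a)"
      by (simp add: nhds_prod)
    from filterlim_compose[OF tendsto_scaleR_Pair this]
    have "((\<lambda>z. c *\<^sub>R z) \<longlongrightarrow> c *\<^sub>R a) (nhds a)"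
      by simp
    then show "((\<lambda>z. c *\<^sub>R z) \<longlongrightarrow> c *\<^sub>R a) (at a within UNIV)"
      by (rule filterlim_mono) (simp_all add: at_within_def)
  qed
  have "continuous_on (closure (S \<times> S)) ?f"
    by (intro continuous_on_add continuous_on_compose2[OF scale] continuous_on_fst
        continuous_on_snd continuous_on_id) auto
  moreover have "?f ` (S \<times> S) \<subseteq> closure S"
  proof clarify
    fix a b assume "a \<in> S" "b \<in> S"
    then have "u *\<^sub>R a + v *\<^sub>R b \<in> S"
      using assms uv by (simp add: convexD)
    then show "u *\<^sub>R fst (a, b) + v *\<^sub>R snd (a, b) \<in> closure S"
      using closure_subset[of S] by auto
  qed
  ultimately have "?f ` closure (S \<times> S) \<subseteq> closure S"
    by (intro image_closure_subset) auto
  moreover have "(x, y) \<in> closure (S \<times> S)"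
    using x y by (simp add: closure_Times)
  ultimately have "?f (x, y) \<in> closure S"
    by blast
  then show "u *\<^sub>R x + v *\<^sub>R y \<in> closure S"
    by simp
qed

lemma closed_convex_hull_eq_closure:
  fixes S :: "'a::locally_convex_space set"
  shows "closed_convex_hull S = closure (convex hull S)"
  unfolding closed_convex_hull_def
proof (rule hull_unique)
  show "S \<subseteq> closure (convex hull S)"
    by (meson closure_subset hull_subset order_trans)
  show "closed (closure (convex hull S)) \<and> convex (closure (convex hull S))"
    by (simp add: convex_closure_lcs)
  show "closure (convex hull S) \<subseteq> C" if "S \<subseteq> C" "closed C \<and> convex C" for C
    using that by (simp add: closure_minimal hull_minimal)
qed

definition core ::
  "(nat \<Rightarrow> 'a::{real_vector, topological_space}) \<Rightarrow> nat set set \<Rightarrow> 'a set" where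
  "core x I = (\<Inter>E\<in>dual_filter I. closed_convex_hull (x ` E))"

end

theory Submission
  imports Defs
begin

text \<open>
  If \<open>p \<notin> F \<eta>\<close>, a small convex neighbourhood \<open>V\<close> of the origin makes \<open>F \<eta> + V\<close> an open convex
  set whose closure misses \<open>p\<close>, and this set contains almost all terms of the sequence; so \<open>p\<close> is not
  in the core. Conversely, if the terms outside an open \<open>U \<supseteq> F \<eta>\<close> were not negligible, compactness
  would provide an ideal cluster point outside \<open>U\<close>, but every cluster point lies in the core.
\<close>

lemma open_translate:
  fixes S :: "'a::topological_ab_group_add set"
  assumes "open S"
  shows "open {a + v |v. v \<in> S}"
proof -
  have "{a + v |v. v \<in> S} = (\<lambda>z. z - a) -` S"
    by (auto simp: algebra_simps) (metis add_diff_cancel_left' diff_add_cancel add.commute)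
  moreover have "open ((\<lambda>z. z - a) -` S)"
    by (intro open_vimage assms continuous_on_diff continuous_on_id continuous_on_const)
  ultimately show ?thesis by simp
qed

text \<open>The sum is a union of translates of \<open>T\<close>. The nested-union form is the one
  \<open>convex_sums\<close> uses, so both facts apply to the same set.\<close>

lemma open_sums_right:
  fixes S T :: "'a::topological_ab_group_add set"
  assumes "open T"
  shows "open (\<Union>a\<in>S. \<Union>b\<in>T. {a + b})"
proof -
  have "(\<Union>a\<in>S. \<Union>b\<in>T. {a + b}) = (\<Union>a\<in>S. {a + v |v. v \<in> T})"
    by auto
  then show ?thesis
    using open_translate[OF assms] by auto
qed

text \<open>Continuity at the origin gives one convex \<open>V\<close> for which
  \<open>p + V\<close> and \<open>C + V\<close> are disjoint; \<open>C + V\<close> then serves as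
  \<open>U\<close>.\<close>

lemma closed_convex_separation:
  fixes C :: "'a::locally_convex_space set"
  assumes "closed C" "convex C" "p \<notin> C"
  obtains U where "open U" "convex U" "C \<subseteq> U" "p \<notin> closure U"
proof -
  \<comment> \<open>A common point \<open>p + a = c + b\<close> of the two translates would make
    \<open>p + a - b\<close> an element of \<open>C\<close>.\<close>
  let ?f = "\<lambda>z::'a \<times> 'a. p + fst z - snd z"
  have "open (?f -` (- C))"
    using assms(1)
    by (intro open_vimage continuous_on_diff continuous_on_add continuous_on_fst
        continuous_on_snd continuous_on_id continuous_on_const) auto
  moreover have "(0, 0) \<in> ?f -` (- C)"
    using assms(3) by simp
  ultimately obtain A B where AB: "open A" "open B" "(0, 0) \<in> A \<times> B" "A \<times> B \<subseteq> ?f -` (- C)"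
    by (rule open_prod_elim)
  then obtain V where V: "open V" "convex V" "0 \<in> V" "V \<subseteq> A \<inter> B"
    using locally_convex_zero_convex[of "A \<inter> B"] by auto
  let ?U = "\<Union>c\<in>C. \<Union>v\<in>V. {c + v}"
  let ?W = "{p + v |v. v \<in> V}"
  have "c + b \<noteq> p + a" if "c \<in> C" "a \<in> V" "b \<in> V" for a b c
  proof
    assume "c + b = p + a"
    then have "p + a - b = c"
      by (metis add_diff_cancel_right')
    moreover have "p + a - b \<notin> C"
      using AB(4) V(4) that by force
    ultimately show False
      using that by simp
  qed
  then have "?W \<inter> ?U = {}"
    by fastforce
  moreover have "open ?W"
    by (rule open_translate[OF V(1)])
  moreover have "p \<in> ?W"
    using V(3) by force
  \<comment> \<open>An open set disjoint from \<open>?U\<close> is disjoint from its closure as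
    well.\<close>
  ultimately have "p \<notin> closure ?U"
    using open_Int_closure_eq_empty[of ?W ?U] by blast
  moreover have "open ?U"
    by (rule open_sums_right[OF V(1)])
  moreover have "convex ?U"
    by (rule convex_sums[OF assms(2) V(2)])
  moreover have "C \<subseteq> ?U"
    using V(3) by force
  ultimately show thesis
    using that by blast
qed

lemma ideal_finite_Union:
  assumes "ideal_on_omega I" "finite \<A>" "\<A> \<subseteq> I"
  shows "\<Union>\<A> \<in> I"
  using assms(2,3,1)
proof (induction \<A> rule: finite_induct)
  case empty
  then show ?case
    by (simp add: ideal_on_omega_def)
next
  case (insert A \<A>)
  then show ?case
    by (auto simp: ideal_on_omega_def)
qed

text \<open>Otherwise every point of \<open>K\<close> has an open neighbourhood whose index set is
  in \<open>I\<close>; finitely many of these cover \<open>K\<close>, and \<open>I\<close> is closed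
  under finite unions.\<close>

lemma compact_ideal_cluster_point:
  fixes x :: "nat \<Rightarrow> 'a::topological_space"
  assumes I: "ideal_on_omega I" and "compact K" and not_I: "{n. x n \<in> K} \<notin> I"
  obtains y where "y \<in> K" "\<And>W. open W \<Longrightarrow> y \<in> W \<Longrightarrow> {n. x n \<in> W} \<notin> I"
proof (rule ccontr)
  assume "\<not> thesis"
  with that have small: "\<exists>W. open W \<and> y \<in> W \<and> {n. x n \<in> W} \<in> I" if "y \<in> K" for y
    using that by metis
  let ?\<W> = "{W. open W \<and> {n. x n \<in> W} \<in> I}"
  have "K \<subseteq> \<Union>?\<W>"
    using small by blast
  then obtain \<D> where \<D>: "\<D> \<subseteq> ?\<W>" "finite \<D>" "K \<subseteq> \<Union>\<D>"
    using compactE[OF assms(2), of ?\<W>] by blast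
  have "\<Union>((\<lambda>W. {n. x n \<in> W}) ` \<D>) \<in> I"
    using \<D> by (intro ideal_finite_Union[OF I]) auto
  moreover have "{n. x n \<in> K} \<subseteq> \<Union>((\<lambda>W. {n. x n \<in> W}) ` \<D>)"
    using \<D>(3) by auto
  ultimately have "{n. x n \<in> K} \<in> I"
    using I unfolding ideal_on_omega_def by blast
  with not_I show False ..
qed

lemma ideal_cluster_point_in_core:
  fixes x :: "nat \<Rightarrow> 'a::locally_convex_space"
  assumes I: "ideal_on_omega I"
    and y: "\<And>W. open W \<Longrightarrow> y \<in> W \<Longrightarrow> {n. x n \<in> W} \<notin> I"
  shows "y \<in> core x I"
  unfolding core_def
proof
  fix E assume "E \<in> dual_filter I"
  then have E: "- E \<in> I"
    by (simp add: dual_filter_def)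
  have "y \<in> closure (x ` E)"
  proof (rule ccontr)
    assume "y \<notin> closure (x ` E)"
    then have "{n. x n \<in> - closure (x ` E)} \<notin> I"
      by (intro y) auto
    moreover have "{n. x n \<in> - closure (x ` E)} \<subseteq> - E"
      using closure_subset[of "x ` E"] by auto
    ultimately show False
      using E I unfolding ideal_on_omega_def by blast
  qed
  then show "y \<in> closed_convex_hull (x ` E)"
    unfolding closed_convex_hull_eq_closure
    using closure_mono[OF hull_subset] by blast
qed

lemma core_subset_if_rough_lim:
  fixes x :: "nat \<Rightarrow> 'a::locally_convex_space"
  assumes "closed (F \<eta>)" "convex (F \<eta>)" and lim: "rough_lim I F x \<eta>"
  shows "core x I \<subseteq> F \<eta>"
proof (rule subsetI, rule ccontr)
  fix p assume p: "p \<in> core x I" and "p \<notin> F \<eta>"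
  then obtain U where U: "open U" "convex U" "F \<eta> \<subseteq> U" "p \<notin> closure U"
    using closed_convex_separation[OF assms(1,2)] by blast
  \<comment> \<open>This index set is one of the sets \<open>E\<close> in the intersection defining
    the core.\<close>
  then have "{n. x n \<in> U} \<in> dual_filter I"
    using lim by (simp add: rough_lim_def dual_filter_def Collect_neg_eq[symmetric])
  then have "p \<in> closure (convex hull (x ` {n. x n \<in> U}))"
    using p by (auto simp: core_def closed_convex_hull_eq_closure)
  moreover have "closure (convex hull (x ` {n. x n \<in> U})) \<subseteq> closure U"
    using U(2) by (intro closure_mono hull_minimal) auto
  ultimately show False
    using U(4) by blast
qed

lemma rough_lim_if_core_subset:
  fixes x :: "nat \<Rightarrow> 'a::locally_convex_space"
  assumes I: "ideal_on_omega I" and K: "compact K" "{n. x n \<notin> K} \<in> I"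
    and core: "core x I \<subseteq> F \<eta>"
  shows "rough_lim I F x \<eta>"
  unfolding rough_lim_def
proof (intro allI impI, rule ccontr)
  fix U assume U: "open U" "F \<eta> \<subseteq> U" and not_I: "{n. x n \<notin> U} \<notin> I"
  \<comment> \<open>Discarding the indices outside \<open>K\<close> costs only a member of
    \<open>I\<close>, which moves the argument to the compact set \<open>K - U\<close>.\<close>
  have "{n. x n \<notin> U} \<subseteq> {n. x n \<in> K - U} \<union> {n. x n \<notin> K}"
    by blast
  then have "{n. x n \<in> K - U} \<notin> I"
    using not_I K(2) I unfolding ideal_on_omega_def by meson
  moreover have "compact (K - U)"
    using K(1) U(1) by (rule compact_diff)
  ultimately obtain y where "y \<in> K - U" "\<And>W. open W \<Longrightarrow> y \<in> W \<Longrightarrow> {n. x n \<in> W} \<notin> I"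
    using compact_ideal_cluster_point[OF I] by blast
  \<comment> \<open>The cluster point \<open>y\<close> avoids \<open>U\<close>, yet it lies in the
    core and hence in \<open>F \<eta> \<subseteq> U\<close>.\<close>
  then show False
    using ideal_cluster_point_in_core[OF I] core U(2) by blast
qed

theorem theorem1p9:
  fixes x :: "nat \<Rightarrow> 'a::locally_convex_space"
    and I :: "nat set set"
    and F :: "'a \<Rightarrow> 'a set"
  assumes "ideal_on_omega I"
    and "\<exists>K. compact K \<and> {n. x n \<notin> K} \<in> I"
    and "rough_family F"
    and "\<And>\<eta>. closed (F \<eta>)"
    and "\<And>\<eta>. convex (F \<eta>)"
  shows "rough_limits x I F = {\<eta>. core x I \<subseteq> F \<eta>}"
  unfolding rough_limits_def
  using core_subset_if_rough_lim[of F] rough_lim_if_core_subset[of I _ x F] assms by blast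

end
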